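(* There is a pseudo-finite model of $\mathsf{MSE}$; that is, there is a pseudo-finite $\mathcal L_e$-structure that satisfies the $\mathrm H$-extensionality axiom and the axiom scheme of excision.
   Context: An $\mathcal L_e$-structure is a nonempty set $M$ with a function $e:M^2\to[0,1]$. Put $d_e(x,y)=\sup_{z\in M}|e(z,x)-e(z,y)|$. Restricted $\mathcal L_e$-formulas are built from atomic formulas $e(x,y)$ ($x,y$ variables) and the constant $1$ using the connectives $\varphi+\psi$, $\max(\varphi,\psi)$, $\min(\varphi,\psi)$, $r\cdot\varphi$ with $r\in\mathbb Q$, and the quantifiers $\sup_x$, $\inf_x$; they are real-valued and evaluated in the obvious way. Put $v(1)=v(e(x,y))=1$, $v(\varphi+\psi)=v(\varphi)+v(\psi)$, $v(\max(\varphi,\psi))=v(\min(\varphi,\psi))=\max(v(\varphi),v(\psi))$, $v(r\varphi)=|r|v(\varphi)$, $v(\sup_x\varphi)=v(\inf_x\varphi)=v(\varphi)$, and $\varepsilon_\varphi=\dfrac{1}{\max(6v(\varphi),3)}$. The $\mathrm H$-extensionality axiom is $\sup_{x,y}\bigl|e(x,y)-\inf_z\min(d_e(x,z)+2e(z,y),1)\bigr|=0$. The axiom scheme of excision consists of the conditions $$\sup_{\bar y}\inf_z\sup_x\max\bigl(\min(e(x,z),-\varphi(x,\bar y)),\ \min(\varepsilon_\varphi-e(x,z),\varphi(x,\bar y)-1)\bigr)\le 0$$ for each restricted $\mathcal L_e$-formula $\varphi(x,\bar y)$ not containing $z$ as a free variable. As an $\mathcal L_e$-theory, $\mathsf{MSE}$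 consists of these axioms. An $\mathcal L_e$-structure $M$ is pseudo-finite if for every restricted $\mathcal L_e$-sentence $\varphi$ and real $r$, if $\varphi^M<r$, then there is a finite $\mathcal L_e$-structure $N$ with $\varphi^N<r$. *)

theory Defs
  imports Complex_Main
begin

text \<open>
  A structure is a carrier set together with a function on the ambient type; only the values of
  the function on the carrier matter.
\<close>

definition Le_structure :: "'a set \<Rightarrow> ('a \<Rightarrow> 'a \<Rightarrow> real) \<Rightarrow> bool" where
  "Le_structure M e \<longleftrightarrow> M \<noteq> {} \<and> (\<forall>x\<in>M. \<forall>y\<in>M. 0 \<le> e x y \<and> e x y \<le> 1)"

definition d_e :: "'a set \<Rightarrow> ('a \<Rightarrow> 'a \<Rightarrow> real) \<Rightarrow> 'a \<Rightarrow> 'a \<Rightarrow> real" where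
  "d_e M e x y = (SUP z\<in>M. \<bar>e z x - e z y\<bar>)"

datatype Le_formula =
    One
  | Elem nat nat
  | Plus Le_formula Le_formula
  | MaxF Le_formula Le_formula
  | MinF Le_formula Le_formula
  | Scale rat Le_formula
  | SupF nat Le_formula
  | InfF nat Le_formula

primrec free_vars :: "Le_formula \<Rightarrow> nat set" where
  "free_vars One = {}"
| "free_vars (Elem x y) = {x, y}"
| "free_vars (Plus \<phi> \<psi>) = free_vars \<phi> \<union> free_vars \<psi>"
| "free_vars (MaxF \<phi> \<psi>) = free_vars \<phi> \<union> free_vars \<psi>"
| "free_vars (MinF \<phi> \<psi>) = free_vars \<phi> \<union> free_vars \<psi>"
| "free_vars (Scale r \<phi>) = free_vars \<phi>"
| "free_vars (SupF x \<phi>) = free_vars \<phi> - {x}"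
| "free_vars (InfF x \<phi>) = free_vars \<phi> - {x}"

primrec eval_formula ::
  "'a set \<Rightarrow> ('a \<Rightarrow> 'a \<Rightarrow> real) \<Rightarrow> (nat \<Rightarrow> 'a) \<Rightarrow> Le_formula \<Rightarrow> real" where
  "eval_formula M e s One = 1"
| "eval_formula M e s (Elem x y) = e (s x) (s y)"
| "eval_formula M e s (Plus \<phi> \<psi>) = eval_formula M e s \<phi> + eval_formula M e s \<psi>"
| "eval_formula M e s (MaxF \<phi> \<psi>) = max (eval_formula M e s \<phi>) (eval_formula M e s \<psi>)"
| "eval_formula M e s (MinF \<phi> \<psi>) = min (eval_formula M e s \<phi>) (eval_formula M e s \<psi>)"
| "eval_formula M e s (Scale r \<phi>) = of_rat r * eval_formula M e s \<phi>"
| "eval_formula M e s (SupF x \<phi>) = (SUP a\<in>M. eval_formula M e (s(x := a)) \<phi>)"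
| "eval_formula M e s (InfF x \<phi>) = (INF a\<in>M. eval_formula M e (s(x := a)) \<phi>)"

definition sentence :: "Le_formula \<Rightarrow> bool" where
  "sentence \<phi> \<longleftrightarrow> free_vars \<phi> = {}"

lemma eval_formula_cong:
  assumes "\<And>x. x \<in> free_vars \<phi> \<Longrightarrow> s x = t x"
  shows "eval_formula M e s \<phi> = eval_formula M e t \<phi>"
  using assms
proof (induction \<phi> arbitrary: s t)
  case (SupF x \<phi>)
  have "eval_formula M e (s(x := a)) \<phi> = eval_formula M e (t(x := a)) \<phi>" for a
    by (rule SupF.IH) (use SupF.prems in auto)
  then show ?case by (simp only: eval_formula.simps)
next
  case (InfF x \<phi>)
  have "eval_formula M e (s(x := a)) \<phi> = eval_formula M e (t(x := a)) \<phi>" for a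
    by (rule InfF.IH) (use InfF.prems in auto)
  then show ?case by (simp only: eval_formula.simps)
next
  case (Plus \<phi> \<psi>)
  show ?case
    using Plus.IH(1)[of s t] Plus.IH(2)[of s t] Plus.prems by simp
next
  case (MaxF \<phi> \<psi>)
  show ?case
    using MaxF.IH(1)[of s t] MaxF.IH(2)[of s t] MaxF.prems by simp
next
  case (MinF \<phi> \<psi>)
  show ?case
    using MinF.IH(1)[of s t] MinF.IH(2)[of s t] MinF.prems by simp
next
  case (Scale r \<phi>)
  show ?case
    using Scale.IH[of s t] Scale.prems by simp
qed simp_all

text \<open>
  By \<open>eval_formula_cong\<close>, the value of a sentence does not depend on the assignment, so an
  arbitrary one can be fixed.
\<close>

definition sentence_value :: "'a set \<Rightarrow> ('a \<Rightarrow> 'a \<Rightarrow> real) \<Rightarrow> Le_formula \<Rightarrow> real" where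
  "sentence_value M e \<phi> = eval_formula M e (\<lambda>_. SOME a. a \<in> M) \<phi>"

primrec v :: "Le_formula \<Rightarrow> real" where
  "v One = 1"
| "v (Elem x y) = 1"
| "v (Plus \<phi> \<psi>) = v \<phi> + v \<psi>"
| "v (MaxF \<phi> \<psi>) = max (v \<phi>) (v \<psi>)"
| "v (MinF \<phi> \<psi>) = max (v \<phi>) (v \<psi>)"
| "v (Scale r \<phi>) = \<bar>of_rat r\<bar> * v \<phi>"
| "v (SupF x \<phi>) = v \<phi>"
| "v (InfF x \<phi>) = v \<phi>"

definition excision_eps :: "Le_formula \<Rightarrow> real" where
  "excision_eps \<phi> = 1 / max (6 * v \<phi>) 3"

definition H_extensionality :: "'a set \<Rightarrow> ('a \<Rightarrow> 'a \<Rightarrow> real) \<Rightarrow> bool" where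
  "H_extensionality M e \<longleftrightarrow>
     (SUP (x, y)\<in>M \<times> M. \<bar>e x y - (INF z\<in>M. min (d_e M e x z + 2 * e z y) 1)\<bar>) = 0"

text \<open>
  The variables \<open>x\<close> and \<open>z\<close> are interpreted by \<open>a\<close> and \<open>b\<close>.  The supremum over the parameter
  tuple is taken over all assignments \<open>s\<close> of the variables in \<open>M\<close>: of these, only the finitely
  many values at the free variables of \<open>\<phi>\<close> other than \<open>x\<close> matter.
\<close>

definition excision :: "'a set \<Rightarrow> ('a \<Rightarrow> 'a \<Rightarrow> real) \<Rightarrow> bool" where
  "excision M e \<longleftrightarrow>
     (\<forall>\<phi> x z. x \<noteq> z \<longrightarrow> z \<notin> free_vars \<phi> \<longrightarrow>
        (SUP s\<in>{s. range s \<subseteq> M}. INF b\<in>M. SUP a\<in>M.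
           max (min (e a b) (- eval_formula M e (s(x := a, z := b)) \<phi>))
               (min (excision_eps \<phi> - e a b) (eval_formula M e (s(x := a, z := b)) \<phi> - 1))) \<le> 0)"

definition MSE_model :: "'a set \<Rightarrow> ('a \<Rightarrow> 'a \<Rightarrow> real) \<Rightarrow> bool" where
  "MSE_model M e \<longleftrightarrow> Le_structure M e \<and> H_extensionality M e \<and> excision M e"

text \<open>
  Every finite structure is isomorphic to one whose carrier is a finite set of natural numbers.
\<close>

definition pseudo_finite :: "'a set \<Rightarrow> ('a \<Rightarrow> 'a \<Rightarrow> real) \<Rightarrow> bool" where
  "pseudo_finite M e \<longleftrightarrow>
     (\<forall>\<phi> r. sentence \<phi> \<longrightarrow> sentence_value M e \<phi> < r \<longrightarrow>
        (\<exists>(N :: nat set) f. Le_structure N f \<and> finite N \<and> sentence_value N f \<phi> < r))"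

text \<open>
  HOL cannot quantify existentially over types, so the elements of the model asserted to exist
  have to be drawn from some fixed type.  The language is countable, so by the downward
  Loewenheim-Skolem theorem any infinite type serves equally well; this one also holds the
  ultraproduct of a sequence of finite structures as it stands.
\<close>

type_synonym universe = "nat \<Rightarrow> nat"

end

theory Submission
  imports Defs "HOL-Library.Nat_Bijection"
begin

text \<open>
  The model is an ultraproduct of explicit finite structures, so that it is pseudo-finite by the
  theorem of Los (\<open>los\<close>, \<open>pseudo_finite_uprod\<close>), and the work consists in finding finite
  structures that satisfy H-extensionality up to an error tending to \<open>0\<close> and each instance of
  excision from some index on.

  Hereditarily finite sets with approximate equality do this.  Call any two sets bisimilar to
  depth \<open>0\<close>, and bisimilar to depth \<open>j + 1\<close> if every member of either is bisimilar to depth \<open>j\<close> to a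
  member of the other.  In the \<open>n\<close>-th structure, \<open>e x y\<close> is the proportion of those depths
  \<open>j \<le> n\<close> to which \<open>x\<close> is not bisimilar to any member of \<open>y\<close>.  If the distance of two sets is the
  proportion of the depths to which they are not bisimilar, then \<open>e x y\<close> is the distance of \<open>x\<close>
  to the nearest member of \<open>y\<close>, while \<open>d_e x y\<close> is the Hausdorff distance of \<open>x\<close> and \<open>y\<close> as sets
  of their members.  Passing from members to sets shifts the depth by one, and hence changes the
  distance by at most \<open>1 / (n + 1)\<close>.  So the space is almost isometric to its own space of
  subsets, and this is what H-extensionality says (\<open>hf_H_extensionality\<close>).

  Finitely many sets represent all sets up to bisimilarity to depth \<open>n\<close>
  (\<open>bisim_representative\<close>), so every subset \<open>S\<close> of the structure, definable or not, has an element \<open>b\<close>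
  whose members represent those of \<open>S\<close>.  Apply this to the set \<open>S\<close> where a formula \<open>\<phi>\<close> is
  negative.  Its elements \<open>a\<close> satisfy \<open>e a b = 0\<close>.  Formulas are Lipschitz with constant \<open>2 v(\<phi>)\<close>
  (\<open>eval_formula_lipschitz\<close>), so a point where \<open>\<phi>\<close> exceeds \<open>1\<close> has distance at least
  \<open>1 / (2 v(\<phi>))\<close> from \<open>S\<close>.  This leaves ample room above \<open>1 / (6 v(\<phi>))\<close> for the rounding errors, and
  excision follows (\<open>hf_excision\<close>).  Russell's paradox does not arise, because the element \<open>b\<close> only
  describes \<open>S\<close> up to a small distance, and formulas are continuous.
\<close>

section \<open>Bounds and moduli of continuity of formulas\<close>

lemma bdd_image_of_abs_le:
  fixes f :: "'a \<Rightarrow> real"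
  assumes "\<And>a. a \<in> M \<Longrightarrow> \<bar>f a\<bar> \<le> B"
  shows "bdd_above (f ` M)" and "bdd_below (f ` M)"
proof -
  have "f a \<le> B" "- B \<le> f a" if "a \<in> M" for a using assms[OF that] by linarith+
  then show "bdd_above (f ` M)" and "bdd_below (f ` M)"
    by - (rule bdd_aboveI2[where M=B], blast, rule bdd_belowI2[where m="- B"], blast)
qed

lemma abs_cSUP_diff_le:
  fixes f g :: "'a \<Rightarrow> real"
  assumes "M \<noteq> {}" and f: "\<And>a. a \<in> M \<Longrightarrow> \<bar>f a\<bar> \<le> B" and g: "\<And>a. a \<in> M \<Longrightarrow> \<bar>g a\<bar> \<le> B"
    and fg: "\<And>a. a \<in> M \<Longrightarrow> \<bar>f a - g a\<bar> \<le> c"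
  shows "\<bar>(SUP a\<in>M. f a) - (SUP a\<in>M. g a)\<bar> \<le> c"
proof -
  have "(SUP a\<in>M. f a) \<le> (SUP a\<in>M. g a) + c"
  proof (rule cSUP_least[OF assms(1)])
    fix a assume a: "a \<in> M"
    show "f a \<le> (SUP a\<in>M. g a) + c"
      using cSUP_upper[OF a bdd_image_of_abs_le(1)[of M g B]] fg[OF a] g by fastforce
  qed
  moreover have "(SUP a\<in>M. g a) \<le> (SUP a\<in>M. f a) + c"
  proof (rule cSUP_least[OF assms(1)])
    fix a assume a: "a \<in> M"
    show "g a \<le> (SUP a\<in>M. f a) + c"
      using cSUP_upper[OF a bdd_image_of_abs_le(1)[of M f B]] fg[OF a] f by fastforce
  qed
  ultimately show ?thesis by linarith
qed

lemma abs_cINF_diff_le: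
  fixes f g :: "'a \<Rightarrow> real"
  assumes "M \<noteq> {}" and f: "\<And>a. a \<in> M \<Longrightarrow> \<bar>f a\<bar> \<le> B" and g: "\<And>a. a \<in> M \<Longrightarrow> \<bar>g a\<bar> \<le> B"
    and fg: "\<And>a. a \<in> M \<Longrightarrow> \<bar>f a - g a\<bar> \<le> c"
  shows "\<bar>(INF a\<in>M. f a) - (INF a\<in>M. g a)\<bar> \<le> c"
proof -
  have "(INF a\<in>M. g a) - c \<le> (INF a\<in>M. f a)"
  proof (rule cINF_greatest[OF assms(1)])
    fix a assume a: "a \<in> M"
    show "(INF a\<in>M. g a) - c \<le> f a"
      using cINF_lower[OF bdd_image_of_abs_le(2)[of M g B] a] fg[OF a] g by fastforce
  qed
  moreover have "(INF a\<in>M. f a) - c \<le> (INF a\<in>M. g a)"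
  proof (rule cINF_greatest[OF assms(1)])
    fix a assume a: "a \<in> M"
    show "(INF a\<in>M. f a) - c \<le> g a"
      using cINF_lower[OF bdd_image_of_abs_le(2)[of M f B] a] fg[OF a] f by fastforce
  qed
  ultimately show ?thesis by linarith
qed

lemma v_nonneg: "0 \<le> v \<phi>"
  by (induction \<phi>) auto

lemma abs_eval_formula_le_v:
  assumes M: "Le_structure M e" and s: "\<And>n. s n \<in> M"
  shows "\<bar>eval_formula M e s \<phi>\<bar> \<le> v \<phi>"
  using s
proof (induction \<phi> arbitrary: s)
  case (Elem x y)
  then show ?case using M by (simp add: Le_structure_def)
next
  case (Scale r \<phi>)
  then show ?case by (simp add: abs_mult mult_left_mono)
next
  case (SupF x \<phi>)
  have "M \<noteq> {}" using M by (simp add: Le_structure_def)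
  moreover have "\<bar>eval_formula M e (s(x := a)) \<phi>\<bar> \<le> v \<phi>" if "a \<in> M" for a
    using SupF that by simp
  ultimately show ?case by (auto intro: cSup_abs_le)
next
  case (InfF x \<phi>)
  have "M \<noteq> {}" using M by (simp add: Le_structure_def)
  moreover have "\<bar>eval_formula M e (s(x := a)) \<phi>\<bar> \<le> v \<phi>" if "a \<in> M" for a
    using InfF that by simp
  ultimately show ?case by (auto intro: cInf_abs_ge)
next
  case (Plus \<phi> \<psi>)
  show ?case using Plus.IH(1)[of s] Plus.IH(2)[of s] Plus.prems by simp
next
  case (MaxF \<phi> \<psi>)
  show ?case using MaxF.IH(1)[of s] MaxF.IH(2)[of s] MaxF.prems by auto
next
  case (MinF \<phi> \<psi>)
  show ?case using MinF.IH(1)[of s] MinF.IH(2)[of s] MinF.prems by auto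
qed auto

text \<open>
  The constant is \<open>2 v(\<phi>)\<close> because an atomic formula \<open>e(x, y)\<close> moves with both of its arguments.
  One uniform bound \<open>D\<close> on the displacement of all variables makes the induction pass through
  quantifiers, which keep the quantified variable in place.
\<close>

lemma eval_formula_lipschitz:
  assumes M: "Le_structure M e"
    and e: "\<And>a b a' b'. \<lbrakk>a \<in> M; b \<in> M; a' \<in> M; b' \<in> M\<rbrakk> \<Longrightarrow>
              \<bar>e a b - e a' b'\<bar> \<le> \<delta> a a' + \<delta> b b'"
    and refl: "\<And>a. a \<in> M \<Longrightarrow> \<delta> a a = 0"
    and st: "\<And>n. s n \<in> M" "\<And>n. t n \<in> M" and D: "\<And>n. \<delta> (s n) (t n) \<le> D" "0 \<le> D"
  shows "\<bar>eval_formula M e s \<phi> - eval_formula M e t \<phi>\<bar> \<le> 2 * v \<phi> * D"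
  using st D(1)
proof (induction \<phi> arbitrary: s t)
  case One
  then show ?case using D(2) by simp
next
  case (Elem x y)
  have "\<bar>e (s x) (s y) - e (t x) (t y)\<bar> \<le> \<delta> (s x) (t x) + \<delta> (s y) (t y)"
    using Elem e by blast
  also have "\<dots> \<le> D + D" using Elem.prems(3) by (intro add_mono)
  finally show ?case by simp
next
  case (Plus \<phi> \<psi>)
  show ?case using Plus.IH(1)[of s t] Plus.IH(2)[of s t] Plus.prems by (simp add: algebra_simps)
next
  case (MaxF \<phi> \<psi>)
  have "v \<phi> * D \<le> max (v \<phi>) (v \<psi>) * D" "v \<psi> * D \<le> max (v \<phi>) (v \<psi>) * D"
    using D(2) by (auto intro: mult_right_mono)
  then show ?case using MaxF.IH(1)[of s t] MaxF.IH(2)[of s t] MaxF.prems by (simp add: abs_le_iff) linarith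
next
  case (MinF \<phi> \<psi>)
  have "v \<phi> * D \<le> max (v \<phi>) (v \<psi>) * D" "v \<psi> * D \<le> max (v \<phi>) (v \<psi>) * D"
    using D(2) by (auto intro: mult_right_mono)
  then show ?case using MinF.IH(1)[of s t] MinF.IH(2)[of s t] MinF.prems by (simp add: abs_le_iff) linarith
next
  case (Scale r \<phi>)
  have "\<bar>eval_formula M e s (Scale r \<phi>) - eval_formula M e t (Scale r \<phi>)\<bar>
      = \<bar>of_rat r\<bar> * \<bar>eval_formula M e s \<phi> - eval_formula M e t \<phi>\<bar>"
    by (simp add: abs_mult flip: right_diff_distrib)
  also have "\<dots> \<le> \<bar>of_rat r\<bar> * (2 * v \<phi> * D)"
    using Scale by (intro mult_left_mono) auto
  finally show ?case by (simp add: algebra_simps)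
next
  case (SupF x \<phi>)
  have "M \<noteq> {}" using M by (simp add: Le_structure_def)
  then show ?case unfolding eval_formula.simps v.simps
  proof (rule abs_cSUP_diff_le[where B="v \<phi>"])
    fix a assume a: "a \<in> M"
    show "\<bar>eval_formula M e (s(x := a)) \<phi> - eval_formula M e (t(x := a)) \<phi>\<bar> \<le> 2 * v \<phi> * D"
      by (rule SupF.IH) (use a SupF.prems D(2) refl in auto)
  qed (use SupF.prems in \<open>auto intro!: abs_eval_formula_le_v[OF M]\<close>)
next
  case (InfF x \<phi>)
  have "M \<noteq> {}" using M by (simp add: Le_structure_def)
  then show ?case unfolding eval_formula.simps v.simps
  proof (rule abs_cINF_diff_le[where B="v \<phi>"])
    fix a assume a: "a \<in> M"
    show "\<bar>eval_formula M e (s(x := a)) \<phi> - eval_formula M e (t(x := a)) \<phi>\<bar> \<le> 2 * v \<phi> * D"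
      by (rule InfF.IH) (use a InfF.prems D(2) refl in auto)
  qed (use InfF.prems in \<open>auto intro!: abs_eval_formula_le_v[OF M]\<close>)
qed


section \<open>Ultrafilters and limits along them\<close>

definition ultrafilter :: "'a filter \<Rightarrow> bool" where
  "ultrafilter U \<longleftrightarrow> U \<noteq> bot \<and> (\<forall>P. eventually P U \<or> eventually (\<lambda>x. \<not> P x) U)"

text \<open>
  In the refinement order, a minimal proper filter is an ultrafilter: if the complement of \<open>P\<close> is
  not large, then restricting the filter to \<open>P\<close> gives a proper filter, which by minimality is the
  same one.  Zorn's lemma applies, since the infimum of a chain of proper filters is proper.
\<close>

lemma ultrafilter_below_exists:
  assumes "F \<noteq> (bot :: 'a filter)"
  shows "\<exists>U \<le> F. ultrafilter U"
proof -
  define A where "A = {G :: 'a filter. G \<noteq> bot \<and> G \<le> F}"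
  have "\<exists>m\<in>A. \<forall>a\<in>A. a \<le> m \<longrightarrow> a = m"
  proof (rule predicate_Zorn[where P="\<lambda>x y. y \<le> x"])
    show "partial_order_on A (relation_of (\<lambda>x y. y \<le> x) A)"
      by (auto simp: partial_order_on_def preorder_on_def refl_on_def trans_def antisym_def
          relation_of_def)
  next
    fix C assume C: "C \<in> Chains (relation_of (\<lambda>x y. y \<le> x) A)"
    have CA: "C \<subseteq> A" and lin: "\<And>G H. G \<in> C \<Longrightarrow> H \<in> C \<Longrightarrow> G \<le> H \<or> H \<le> G"
      using C by (auto simp: Chains_def relation_of_def)
    show "\<exists>u\<in>A. \<forall>a\<in>C. u \<le> a"
    proof (cases "C = {}")
      case True
      then show ?thesis using assms by (auto simp: A_def)
    next
      case False
      have "eventually (\<lambda>_. False) (Inf C) \<longleftrightarrow> (\<exists>G\<in>C. eventually (\<lambda>_. False) G)"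
        by (rule eventually_Inf_base[OF False]) (use lin in \<open>fastforce simp: le_inf_iff\<close>)
      then have "Inf C \<noteq> bot"
        using CA by (auto simp: A_def trivial_limit_def)
      moreover have "Inf C \<le> F"
        using False CA by (auto simp: A_def intro: Inf_lower2)
      ultimately show ?thesis by (auto simp: A_def intro: Inf_lower)
    qed
  qed
  then obtain U where U: "U \<in> A" and min: "\<And>G. G \<in> A \<Longrightarrow> G \<le> U \<Longrightarrow> G = U" by blast
  have "eventually P U" if "\<not> eventually (\<lambda>x. \<not> P x) U" for P
  proof -
    have "inf U (principal {x. P x}) \<in> A"
      using U that by (auto simp: A_def trivial_limit_def eventually_inf_principal intro: le_infI1)
    then have "inf U (principal {x. P x}) = U" using min by simp
    then show ?thesis
      using eventually_inf_principal[of P U "{x. P x}"] by simp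
  qed
  then have "ultrafilter U" using U by (auto simp: ultrafilter_def A_def)
  then show ?thesis using U by (auto simp: A_def)
qed

lemma ultrafilter_bounded_tendsto_Lim:
  fixes f :: "'a \<Rightarrow> real"
  assumes U: "ultrafilter U" and f: "\<And>i. \<bar>f i\<bar> \<le> B"
  shows "(f \<longlongrightarrow> Lim U f) U"
proof -
  have nb: "U \<noteq> bot" using U by (simp add: ultrafilter_def)
  \<comment> \<open>The limit is the largest number that \<open>f\<close> almost reaches on a large set.\<close>
  define R where "R = {r. eventually (\<lambda>i. r \<le> f i) U}"
  have f': "- B \<le> f i" "f i \<le> B" for i using f[of i] by linarith+
  have R: "-B \<in> R" using f' by (simp add: R_def)
  have "r \<le> B" if "r \<in> R" for r
  proof -
    have "eventually (\<lambda>i. r \<le> f i) U" using that by (simp add: R_def)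
    from eventually_happens[OF this] nb obtain i where "r \<le> f i" by auto
    then show ?thesis using f'[of i] by linarith
  qed
  then have bdd: "bdd_above R" by (rule bdd_aboveI)
  have "(f \<longlongrightarrow> Sup R) U"
  proof (rule order_tendstoI)
    fix a assume "a < Sup R"
    then obtain r where "r \<in> R" "a < r" using less_cSup_iff[of R a] R bdd by blast
    then show "eventually (\<lambda>i. a < f i) U" unfolding R_def by (auto elim: eventually_mono)
  next
    fix a assume "Sup R < a"
    then have "a \<notin> R" using cSup_upper[OF _ bdd, of a] by linarith
    then have "eventually (\<lambda>i. \<not> a \<le> f i) U"
      using U unfolding ultrafilter_def R_def by blast
    then show "eventually (\<lambda>i. f i < a) U" by (simp add: not_le)
  qed
  then show ?thesis using tendsto_Lim[OF nb] by metis
qed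


section \<open>Ultraproducts of finite structures\<close>

text \<open>
  The elements are the choice sequences themselves, not their classes modulo the ultrafilter.
  Structures carry no equality symbol, so elements that agree on a large set do no harm, and the
  carrier stays in the function type.
\<close>

definition uprod_carrier :: "('i \<Rightarrow> 'a set) \<Rightarrow> ('i \<Rightarrow> 'a) set" where
  "uprod_carrier A = {a. \<forall>i. a i \<in> A i}"

definition uprod_elem ::
  "'i filter \<Rightarrow> ('i \<Rightarrow> 'a \<Rightarrow> 'a \<Rightarrow> real) \<Rightarrow> ('i \<Rightarrow> 'a) \<Rightarrow> ('i \<Rightarrow> 'a) \<Rightarrow> real" where
  "uprod_elem U E a b = Lim U (\<lambda>i. E i (a i) (b i))"

lemma uprod_elem_tendsto:
  assumes U: "ultrafilter U" and A: "\<And>i. Le_structure (A i) (E i)"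
    and ab: "a \<in> uprod_carrier A" "b \<in> uprod_carrier A"
  shows "((\<lambda>i. E i (a i) (b i)) \<longlongrightarrow> uprod_elem U E a b) U"
  unfolding uprod_elem_def
  by (rule ultrafilter_bounded_tendsto_Lim[OF U, where B=1])
    (use A ab in \<open>auto simp: Le_structure_def uprod_carrier_def\<close>)

lemma Le_structure_uprod:
  assumes U: "ultrafilter U" and A: "\<And>i. Le_structure (A i) (E i)"
  shows "Le_structure (uprod_carrier A) (uprod_elem U E)"
proof -
  have "\<forall>i. \<exists>a. a \<in> A i" using A by (simp add: Le_structure_def ex_in_conv)
  then have ne: "uprod_carrier A \<noteq> {}" by (auto simp: uprod_carrier_def dest: choice)
  have nb: "U \<noteq> bot" using U by (simp add: ultrafilter_def)
  have "0 \<le> uprod_elem U E a b \<and> uprod_elem U E a b \<le> 1"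
    if ab: "a \<in> uprod_carrier A" "b \<in> uprod_carrier A" for a b
  proof
    have E: "0 \<le> E i (a i) (b i)" "E i (a i) (b i) \<le> 1" for i
      using A[of i] ab by (auto simp: Le_structure_def uprod_carrier_def)
    show "0 \<le> uprod_elem U E a b"
      by (rule tendsto_lowerbound[OF uprod_elem_tendsto[where A=A] _ nb]) (use U A ab E in auto)
    show "uprod_elem U E a b \<le> 1"
      by (rule tendsto_upperbound[OF uprod_elem_tendsto[where A=A] _ nb]) (use U A ab E in auto)
  qed
  then show ?thesis using ne by (simp add: Le_structure_def)
qed

text \<open>
  Limits along an ultrafilter commute with the connectives because these are continuous.  For a
  quantifier, finiteness of the factors lets the supremum be attained in each of them; the sequence
  of maximisers is an element of the ultraproduct, and the limit inequalities make it a maximiser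
  there.
\<close>

theorem los:
  assumes U: "ultrafilter U" and A: "\<And>i. Le_structure (A i) (E i)" and fin: "\<And>i. finite (A i)"
    and s: "\<And>n. s n \<in> uprod_carrier A"
  shows "((\<lambda>i. eval_formula (A i) (E i) (\<lambda>n. s n i) \<phi>)
            \<longlongrightarrow> eval_formula (uprod_carrier A) (uprod_elem U E) s \<phi>) U"
  using s
proof (induction \<phi> arbitrary: s)
  case (Elem x y)
  then show ?case using uprod_elem_tendsto[where A=A and E=E, OF U A] by simp
next
  case (SupF x \<phi>)
  have nb: "U \<noteq> bot" using U by (simp add: ultrafilter_def)
  have ne: "A i \<noteq> {}" for i using A[of i] by (simp add: Le_structure_def)
  define g where "g i a = eval_formula (A i) (E i) ((\<lambda>n. s n i)(x := a)) \<phi>" for i a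
  define G where "G a = eval_formula (uprod_carrier A) (uprod_elem U E) (s(x := a)) \<phi>" for a
  have lim: "((\<lambda>i. g i (a i)) \<longlongrightarrow> G a) U" if "a \<in> uprod_carrier A" for a
  proof -
    have "(\<lambda>n. (s(x := a)) n i) = (\<lambda>n. s n i)(x := a i)" for i by auto
    moreover have "\<And>n. (s(x := a)) n \<in> uprod_carrier A" using SupF.prems that by simp
    ultimately show ?thesis using SupF.IH[of "s(x := a)"] by (simp add: g_def G_def del: fun_upd_apply)
  qed
  have upper: "g i a \<le> (SUP a\<in>A i. g i a)" if "a \<in> A i" for i a
    using that fin by (intro cSUP_upper bdd_above_finite) auto
  have "(SUP a\<in>A i. g i a) \<in> g i ` A i" for i by (metis cSup_eq_Max Max_in finite_imageI fin image_is_empty ne)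
  then have "\<forall>i. \<exists>a. a \<in> A i \<and> (SUP a\<in>A i. g i a) = g i a" by blast
  then obtain a where a: "\<And>i. a i \<in> A i" "\<And>i. (SUP a\<in>A i. g i a) = g i (a i)" by metis
  have aM: "a \<in> uprod_carrier A" using a by (simp add: uprod_carrier_def)
  have "(SUP a\<in>uprod_carrier A. G a) = G a"
  proof (rule cSup_eq_maximum)
    fix y assume "y \<in> G ` uprod_carrier A"
    then obtain b where b: "b \<in> uprod_carrier A" "y = G b" by blast
    have "g i (b i) \<le> g i (a i)" for i
      using upper[of "b i" i] b a by (simp add: uprod_carrier_def)
    then show "y \<le> G a" using tendsto_le[OF nb lim[OF aM] lim[OF b(1)]] b by simp
  qed (use aM in auto)
  then show ?case using lim[OF aM] by (simp add: a(2) flip: g_def G_def)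
next
  case (InfF x \<phi>)
  have nb: "U \<noteq> bot" using U by (simp add: ultrafilter_def)
  have ne: "A i \<noteq> {}" for i using A[of i] by (simp add: Le_structure_def)
  define g where "g i a = eval_formula (A i) (E i) ((\<lambda>n. s n i)(x := a)) \<phi>" for i a
  define G where "G a = eval_formula (uprod_carrier A) (uprod_elem U E) (s(x := a)) \<phi>" for a
  have lim: "((\<lambda>i. g i (a i)) \<longlongrightarrow> G a) U" if "a \<in> uprod_carrier A" for a
  proof -
    have "(\<lambda>n. (s(x := a)) n i) = (\<lambda>n. s n i)(x := a i)" for i by auto
    moreover have "\<And>n. (s(x := a)) n \<in> uprod_carrier A" using InfF.prems that by simp
    ultimately show ?thesis using InfF.IH[of "s(x := a)"] by (simp add: g_def G_def del: fun_upd_apply)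
  qed
  have lower: "(INF a\<in>A i. g i a) \<le> g i a" if "a \<in> A i" for i a
    using that fin by (intro cINF_lower bdd_below_finite) auto
  have "(INF a\<in>A i. g i a) \<in> g i ` A i" for i by (metis cInf_eq_Min Min_in finite_imageI fin image_is_empty ne)
  then have "\<forall>i. \<exists>a. a \<in> A i \<and> (INF a\<in>A i. g i a) = g i a" by blast
  then obtain a where a: "\<And>i. a i \<in> A i" "\<And>i. (INF a\<in>A i. g i a) = g i (a i)" by metis
  have aM: "a \<in> uprod_carrier A" using a by (simp add: uprod_carrier_def)
  have "(INF a\<in>uprod_carrier A. G a) = G a"
  proof (rule cInf_eq_minimum)
    fix y assume "y \<in> G ` uprod_carrier A"
    then obtain b where b: "b \<in> uprod_carrier A" "y = G b" by blast
    have "g i (a i) \<le> g i (b i)" for i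
      using lower[of "b i" i] b a by (simp add: uprod_carrier_def)
    then show "G a \<le> y" using tendsto_le[OF nb lim[OF b(1)] lim[OF aM]] b by simp
  qed (use aM in auto)
  then show ?case using lim[OF aM] by (simp add: a(2) flip: g_def G_def)
qed (simp_all add: tendsto_add tendsto_max tendsto_min tendsto_mult_left)

lemma pseudo_finite_uprod:
  fixes A :: "'i \<Rightarrow> nat set"
  assumes U: "ultrafilter U" and A: "\<And>i. Le_structure (A i) (E i)" and fin: "\<And>i. finite (A i)"
  shows "pseudo_finite (uprod_carrier A) (uprod_elem U E)"
  unfolding pseudo_finite_def
proof (intro allI impI)
  fix \<phi> r
  assume \<phi>: "sentence \<phi>" and r: "sentence_value (uprod_carrier A) (uprod_elem U E) \<phi> < r"
  define a where "a = (SOME a. a \<in> uprod_carrier A)"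
  have a: "a \<in> uprod_carrier A"
    using Le_structure_uprod[OF U A] unfolding a_def by (simp add: Le_structure_def some_in_eq)
  have val: "sentence_value (A i) (E i) \<phi> = eval_formula (A i) (E i) (\<lambda>_. a i) \<phi>" for i
    unfolding sentence_value_def by (rule eval_formula_cong) (use \<phi> in \<open>simp add: sentence_def\<close>)
  have "((\<lambda>i. sentence_value (A i) (E i) \<phi>)
      \<longlongrightarrow> sentence_value (uprod_carrier A) (uprod_elem U E) \<phi>) U"
    using los[where A=A and E=E and s="\<lambda>_. a", OF U A fin a]
    by (simp add: val) (simp add: sentence_value_def a_def)
  from eventually_happens[OF order_tendstoD(2)[OF this r]] U obtain i where "sentence_value (A i) (E i) \<phi> < r"
    by (auto simp: ultrafilter_def)
  then show "\<exists>(N :: nat set) f. Le_structure N f \<and> finite N \<and> sentence_value N f \<phi> < r"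
    using A fin by blast
qed


section \<open>Bounded bisimilarity of hereditarily finite sets\<close>

text \<open>
  Natural numbers code the hereditarily finite sets by Ackermann's coding, in which the members of
  \<open>x\<close> are the positions of the binary digits \<open>1\<close> of \<open>x\<close>.
\<close>

primrec bisim :: "nat \<Rightarrow> nat \<Rightarrow> nat \<Rightarrow> bool" where
  "bisim 0 x y \<longleftrightarrow> True"
| "bisim (Suc j) x y \<longleftrightarrow>
     (\<forall>a\<in>set_decode x. \<exists>b\<in>set_decode y. bisim j a b) \<and>
     (\<forall>b\<in>set_decode y. \<exists>a\<in>set_decode x. bisim j a b)"

lemma bisim_refl [simp]: "bisim j x x"
  by (induction j arbitrary: x) auto

lemma bisim_sym: "bisim j x y \<Longrightarrow> bisim j y x"
  by (induction j arbitrary: x y) (simp, fastforce)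

lemma bisim_trans: "bisim j x y \<Longrightarrow> bisim j y z \<Longrightarrow> bisim j x z"
  by (induction j arbitrary: x y z) (simp, simp, meson)

lemma bisim_Suc_imp: "bisim (Suc j) x y \<Longrightarrow> bisim j x y"
proof (induction j arbitrary: x y)
  case (Suc j)
  then show ?case unfolding bisim.simps(2)[of "Suc j"] bisim.simps(2)[of j x y] by meson
qed simp

lemma bisim_antimono: "i \<le> j \<Longrightarrow> bisim j x y \<Longrightarrow> bisim i x y"
  by (induction rule: dec_induct) (auto dest: bisim_Suc_imp simp del: bisim.simps)

definition near :: "nat \<Rightarrow> nat \<Rightarrow> nat \<Rightarrow> bool" where
  "near j x y \<longleftrightarrow> (\<exists>b\<in>set_decode y. bisim j x b)"

lemma near_antimono: "i \<le> j \<Longrightarrow> near j x y \<Longrightarrow> near i x y"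
  unfolding near_def using bisim_antimono by blast

lemma near_bisim_left: "bisim j x x' \<Longrightarrow> near j x y \<Longrightarrow> near j x' y"
  unfolding near_def using bisim_trans bisim_sym by blast

lemma near_bisim_right: "bisim (Suc j) y y' \<Longrightarrow> near j x y \<Longrightarrow> near j x y'"
  unfolding near_def bisim.simps using bisim_trans by blast

text \<open>The levels of the cumulative hierarchy.\<close>

primrec hf_level :: "nat \<Rightarrow> nat set" where
  "hf_level 0 = {}"
| "hf_level (Suc n) = {x. set_decode x \<subseteq> hf_level n}"

lemma finite_hf_level: "finite (hf_level n)"
proof (induction n)
  case (Suc n)
  have "hf_level (Suc n) \<subseteq> set_encode ` Pow (hf_level n)"
  proof
    fix x assume "x \<in> hf_level (Suc n)"
    then show "x \<in> set_encode ` Pow (hf_level n)"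
      by (intro image_eqI[where x="set_decode x"]) auto
  qed
  then show ?case using Suc finite_subset by blast
qed simp

lemma hf_level_subset_Suc: "hf_level n \<subseteq> hf_level (Suc n)"
  by (induction n) auto

lemma member_hf_level: "x \<in> hf_level n \<Longrightarrow> a \<in> set_decode x \<Longrightarrow> a \<in> hf_level n"
  using hf_level_subset_Suc by (cases n) auto

text \<open>
  Bisimilarity to depth \<open>j\<close> does not see members nested more than \<open>j\<close> deep, so a set can be
  truncated at that depth.
\<close>

lemma bisim_representative: "\<exists>y\<in>hf_level (Suc j). bisim j x y"
proof (induction j arbitrary: x)
  case 0
  then show ?case by (auto intro: exI[of _ 0])
next
  case (Suc j)
  then obtain t where t: "\<And>a. t a \<in> hf_level (Suc j)" "\<And>a. bisim j a (t a)" by metis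
  define y where "y = set_encode (t ` set_decode x)"
  have y: "set_decode y = t ` set_decode x" by (simp add: y_def)
  have "bisim (Suc j) x y" using t(2) by (auto simp: y)
  moreover have "y \<in> hf_level (Suc (Suc j))" using t(1) y by auto
  ultimately show ?case by blast
qed

lemma zero_mem_hf_level [simp]: "0 \<in> hf_level (Suc n)"
  by simp

declare hf_level.simps(2) [simp del]


section \<open>The finite structures\<close>

text \<open>
  The carrier is one level above the representatives for depth \<open>n\<close>, so that it contains every set
  of such representatives.
\<close>

abbreviation hf_carrier :: "nat \<Rightarrow> nat set" where
  "hf_carrier n \<equiv> hf_level (Suc (Suc n))"

definition freq :: "nat \<Rightarrow> (nat \<Rightarrow> bool) \<Rightarrow> real" where
  "freq n P = real (card {j. j \<le> n \<and> P j}) / real (Suc n)"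

definition hf_elem :: "nat \<Rightarrow> nat \<Rightarrow> nat \<Rightarrow> real" where
  "hf_elem n x y = freq n (\<lambda>j. \<not> near j x y)"

text \<open>
  The depth is shifted by one against \<open>hf_elem\<close>: this is the distance of \<open>x\<close> and \<open>y\<close> measured through
  their members, an upper bound for \<open>d_e\<close>.
\<close>

definition hf_dist :: "nat \<Rightarrow> nat \<Rightarrow> nat \<Rightarrow> real" where
  "hf_dist n x y = freq n (\<lambda>j. \<not> bisim (Suc j) x y)"

lemma freq_nonneg: "0 \<le> freq n P"
  by (simp add: freq_def)

lemma freq_le_one: "freq n P \<le> 1"
proof -
  have "card {j. j \<le> n \<and> P j} \<le> card {..n}" by (rule card_mono) auto
  then show ?thesis by (simp add: freq_def divide_le_eq)
qed

lemma freq_mono: "(\<And>j. j \<le> n \<Longrightarrow> P j \<Longrightarrow> Q j) \<Longrightarrow> freq n P \<le> freq n Q"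
  unfolding freq_def by (intro divide_right_mono of_nat_mono card_mono) auto

lemma freq_disj_le:
  assumes "\<And>j. j \<le> n \<Longrightarrow> P j \<Longrightarrow> Q j \<or> R j"
  shows "freq n P \<le> freq n Q + freq n R"
proof -
  have "card {j. j \<le> n \<and> P j} \<le> card ({j. j \<le> n \<and> Q j} \<union> {j. j \<le> n \<and> R j})"
    by (rule card_mono) (use assms in auto)
  also have "\<dots> \<le> card {j. j \<le> n \<and> Q j} + card {j. j \<le> n \<and> R j}" by (rule card_Un_le)
  finally show ?thesis by (simp add: freq_def divide_right_mono flip: add_divide_distrib of_nat_add)
qed

lemma freq_eq_index_le: "freq n (\<lambda>j. j = k) \<le> 1 / real (Suc n)"
proof -
  have "card {j. j \<le> n \<and> j = k} \<le> card {k}" by (rule card_mono) auto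
  then show ?thesis by (simp add: freq_def divide_right_mono)
qed

lemma freq_eq_0: "(\<And>j. j \<le> n \<Longrightarrow> \<not> P j) \<Longrightarrow> freq n P = 0"
  by (simp add: freq_def)

lemma freq_eq_1: "(\<And>j. j \<le> n \<Longrightarrow> P j) \<Longrightarrow> freq n P = 1"
proof -
  assume "\<And>j. j \<le> n \<Longrightarrow> P j"
  then have "{j. j \<le> n \<and> P j} = {..n}" by auto
  then show ?thesis by (simp add: freq_def)
qed

lemma Le_structure_hf: "Le_structure (hf_carrier n) (hf_elem n)"
proof -
  have "0 \<in> hf_carrier n" by simp
  then show ?thesis
    unfolding Le_structure_def hf_elem_def using freq_nonneg freq_le_one by blast
qed

lemma hf_dist_nonneg: "0 \<le> hf_dist n x y"
  by (simp add: hf_dist_def freq_nonneg)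

lemma hf_dist_triangle: "hf_dist n x z \<le> hf_dist n x y + hf_dist n y z"
  unfolding hf_dist_def by (rule freq_disj_le) (blast intro: bisim_trans)

lemma hf_dist_sym: "hf_dist n x y = hf_dist n y x"
  unfolding hf_dist_def using bisim_sym by metis

lemma hf_elem_le_left: "hf_elem n x z \<le> freq n (\<lambda>j. \<not> bisim j x y) + hf_elem n y z"
  unfolding hf_elem_def
  by (rule freq_disj_le) (blast intro: near_bisim_left bisim_sym)

lemma freq_bisim_le_hf_dist: "freq n (\<lambda>j. \<not> bisim j x y) \<le> hf_dist n x y"
  unfolding hf_dist_def by (rule freq_mono) (blast intro: bisim_Suc_imp)

lemma hf_elem_le_right: "hf_elem n z x \<le> hf_elem n z y + hf_dist n x y"
  unfolding hf_elem_def hf_dist_def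
  by (rule freq_disj_le) (blast intro: near_bisim_right bisim_sym)

lemma hf_elem_lipschitz:
  "\<bar>hf_elem n a b - hf_elem n a' b'\<bar> \<le> hf_dist n a a' + hf_dist n b b'"
proof -
  have *: "hf_elem n a b \<le> hf_elem n a' b' + (hf_dist n a a' + hf_dist n b b')" for a b a' b'
    using hf_elem_le_left[of n a b a'] hf_elem_le_right[of n a' b b']
      freq_bisim_le_hf_dist[of n a a'] by linarith
  show ?thesis
    using *[of a b a' b'] *[of a' b' a b] hf_dist_sym[of n a a'] hf_dist_sym[of n b b'] by linarith
qed

lemma hf_elem_member: "a \<in> set_decode x \<Longrightarrow> hf_elem n a x = 0"
  unfolding hf_elem_def near_def by (rule freq_eq_0) (blast intro: bisim_refl)

lemma hf_elem_empty: "set_decode y = {} \<Longrightarrow> hf_elem n x y = 1"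
  unfolding hf_elem_def near_def by (rule freq_eq_1) simp

text \<open>
  The witness is a member \<open>b\<close> of \<open>y\<close> that is bisimilar to \<open>x\<close> up to the largest depth \<open>J\<close> for which
  there is such a member.  The error term comes from the single depth \<open>j = J\<close>, since \<open>hf_dist\<close>
  compares \<open>x\<close> and \<open>b\<close> to depth \<open>J + 1\<close> there.
\<close>

lemma hf_elem_attained:
  assumes "set_decode y \<noteq> {}"
  obtains b where "b \<in> set_decode y" "hf_dist n x b \<le> hf_elem n x y + 1 / real (Suc n)"
proof -
  have "near 0 x y" using assms by (auto simp: near_def)
  then have ex: "\<exists>j. j \<le> n \<and> near j x y" by blast
  define J where "J = (GREATEST j. j \<le> n \<and> near j x y)"
  have J: "near J x y"
    using GreatestI_ex_nat[OF ex, of n] by (simp add: J_def)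
  have max: "j \<le> J" if "j \<le> n" "near j x y" for j
    unfolding J_def by (rule Greatest_le_nat[of _ _ n]) (use that in auto)
  obtain b where b: "b \<in> set_decode y" "bisim J x b" using J by (auto simp: near_def)
  have "hf_dist n x b \<le> hf_elem n x y + freq n (\<lambda>j. j = J)"
    unfolding hf_dist_def hf_elem_def
  proof (rule freq_disj_le)
    fix j assume j: "j \<le> n" "\<not> bisim (Suc j) x b"
    have "\<not> Suc j \<le> J" using bisim_antimono b(2) j(2) by blast
    then show "\<not> near j x y \<or> j = J" using max[OF j(1)] by linarith
  qed
  then show ?thesis using that[OF b(1)] freq_eq_index_le[of n J] by linarith
qed

text \<open>
  Both bounds compare depths.  For the lower bound, let \<open>i + 1\<close> be the first depth to which \<open>x\<close> and
  \<open>y\<close> are not bisimilar (depth \<open>0\<close> never fails).  Then one of them has a member \<open>a\<close> that from depth \<open>i\<close> on is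
  near no member of the other; as the carrier is transitive, this \<open>a\<close> takes part in the
  supremum that defines \<open>d_e\<close>.
\<close>

lemma
  assumes "x \<in> hf_carrier n" "y \<in> hf_carrier n"
  shows d_e_hf_le: "d_e (hf_carrier n) (hf_elem n) x y \<le> hf_dist n x y"
    and d_e_hf_ge: "freq n (\<lambda>j. \<not> bisim j x y) \<le> d_e (hf_carrier n) (hf_elem n) x y"
proof -
  have le: "\<bar>hf_elem n z x - hf_elem n z y\<bar> \<le> hf_dist n x y" for z
    using hf_elem_le_right[of n z x y] hf_elem_le_right[of n z y x] hf_dist_sym[of n x y]
    by linarith
  have "0 \<in> hf_carrier n" by simp
  then have "hf_carrier n \<noteq> {}" by blast
  then show "d_e (hf_carrier n) (hf_elem n) x y \<le> hf_dist n x y"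
    unfolding d_e_def using le by (intro cSUP_least) auto
  have bdd: "bdd_above ((\<lambda>z. \<bar>hf_elem n z x - hf_elem n z y\<bar>) ` hf_carrier n)"
    using finite_hf_level by (intro bdd_above_finite finite_imageI)
  have d: "\<bar>hf_elem n z x - hf_elem n z y\<bar> \<le> d_e (hf_carrier n) (hf_elem n) x y"
    if "z \<in> hf_carrier n" for z
    unfolding d_e_def by (rule cSUP_upper[OF that bdd])
  have key: "freq n (\<lambda>j. \<not> bisim j x y) \<le> hf_elem n a w"
    if "\<not> near i a w" and i: "\<And>j. \<not> bisim j x y \<Longrightarrow> i \<le> j" for i a w
    unfolding hf_elem_def using that near_antimono by (intro freq_mono) blast
  show "freq n (\<lambda>j. \<not> bisim j x y) \<le> d_e (hf_carrier n) (hf_elem n) x y"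
  proof (cases "\<exists>j. \<not> bisim j x y")
    case False
    then have "freq n (\<lambda>j. \<not> bisim j x y) = 0" by (intro freq_eq_0) auto
    then show ?thesis using d[OF \<open>0 \<in> hf_carrier n\<close>] by linarith
  next
    case True
    define j where "j = (LEAST j. \<not> bisim j x y)"
    have nj: "\<not> bisim j x y" using LeastI_ex[OF True] by (simp add: j_def)
    have least: "j \<le> l" if "\<not> bisim l x y" for l
      unfolding j_def using that by (rule Least_le)
    obtain i where i: "j = Suc i" using nj by (cases j) auto
    have il: "i \<le> l" if "\<not> bisim l x y" for l using least[OF that] i by linarith
    consider a where "a \<in> set_decode x" "\<not> near i a y" | a where "a \<in> set_decode y" "\<not> near i a x"
      using nj unfolding i bisim.simps near_def using bisim_sym by blast
    then show ?thesis
    proof cases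
      case 1
      then show ?thesis
        using d[OF member_hf_level[OF assms(1) 1(1)]] hf_elem_member[OF 1(1), of n]
          key[OF 1(2) il] by linarith
    next
      case 2
      then show ?thesis
        using d[OF member_hf_level[OF assms(2) 2(1)]] hf_elem_member[OF 2(1), of n]
          key[OF 2(2) il] by linarith
    qed
  qed
qed

text \<open>
  The infimum is at least \<open>e x y\<close> by the triangle inequality, and it is almost reached at the
  member \<open>z\<close> of \<open>y\<close> nearest to \<open>x\<close>, where \<open>e z y = 0\<close>.
\<close>

lemma hf_H_extensionality:
  assumes x: "x \<in> hf_carrier n" and y: "y \<in> hf_carrier n"
  shows "\<bar>hf_elem n x y - (INF z\<in>hf_carrier n.
           min (d_e (hf_carrier n) (hf_elem n) x z + 2 * hf_elem n z y) 1)\<bar> \<le> 1 / real (Suc n)"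
proof -
  define h where "h z = min (d_e (hf_carrier n) (hf_elem n) x z + 2 * hf_elem n z y) 1" for z
  have ne: "hf_carrier n \<noteq> {}" using x by blast
  have bdd: "bdd_below (h ` hf_carrier n)"
    using finite_hf_level by (intro bdd_below_finite finite_imageI)
  have "hf_elem n x y \<le> (INF z\<in>hf_carrier n. h z)"
  proof (rule cINF_greatest[OF ne])
    fix z assume z: "z \<in> hf_carrier n"
    have "hf_elem n x y \<le> d_e (hf_carrier n) (hf_elem n) x z + 2 * hf_elem n z y"
      using hf_elem_le_left[of n x y z] d_e_hf_ge[OF x z] freq_nonneg[of n "\<lambda>j. \<not> near j z y"]
      by (simp add: hf_elem_def)
    then show "hf_elem n x y \<le> h z"
      using freq_le_one[of n "\<lambda>j. \<not> near j x y"] by (simp add: h_def hf_elem_def)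
  qed
  moreover have "(INF z\<in>hf_carrier n. h z) \<le> hf_elem n x y + 1 / real (Suc n)"
  proof (cases "set_decode y = {}")
    case True
    have "(INF z\<in>hf_carrier n. h z) \<le> h x" by (rule cINF_lower[OF bdd x])
    also have "\<dots> \<le> 1" by (simp add: h_def)
    finally show ?thesis using hf_elem_empty[OF True, of n x] by (simp add: add_increasing2)
  next
    case False
    then obtain b where b: "b \<in> set_decode y" "hf_dist n x b \<le> hf_elem n x y + 1 / real (Suc n)"
      by (rule hf_elem_attained)
    have bc: "b \<in> hf_carrier n" using member_hf_level[OF y b(1)] .
    have "(INF z\<in>hf_carrier n. h z) \<le> h b" by (rule cINF_lower[OF bdd bc])
    also have "\<dots> \<le> d_e (hf_carrier n) (hf_elem n) x b"
      by (simp add: h_def hf_elem_member[OF b(1)])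
    finally show ?thesis using d_e_hf_le[OF x bc] b(2) by linarith
  qed
  ultimately show ?thesis unfolding h_def by linarith
qed

text \<open>
  The element \<open>b\<close> collects the representatives of all \<open>a\<close> at which \<open>\<phi>\<close> is negative.  Suppose that \<open>\<phi>\<close>
  exceeds \<open>1\<close> at \<open>a\<close>, and that \<open>a'\<close> is an element of negative value whose representative is nearest
  to \<open>a\<close>.  Then the distance of \<open>a\<close> and \<open>a'\<close> is at most \<open>e a b + 2 / (n + 1)\<close>, with one error from the
  shift of depth and one from the truncation, so that
  \<open>1 < 2 v(\<phi>) (e a b + 2 / (n + 1))\<close>.  For \<open>n + 1 \<ge> 6 v(\<phi>)\<close> the error contributes at most
  \<open>2 / 3\<close>, and \<open>e a b \<ge> 1 / (6 v(\<phi>))\<close> remains.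
\<close>

lemma hf_excision:
  assumes s: "\<And>k. s k \<in> hf_carrier n" and n: "6 * v \<phi> \<le> real (Suc n)"
  obtains b where "b \<in> hf_carrier n"
    and "\<And>a. a \<in> hf_carrier n \<Longrightarrow> eval_formula (hf_carrier n) (hf_elem n) (s(x := a)) \<phi> < 0 \<Longrightarrow>
          hf_elem n a b = 0"
    and "\<And>a. a \<in> hf_carrier n \<Longrightarrow> 1 < eval_formula (hf_carrier n) (hf_elem n) (s(x := a)) \<phi> \<Longrightarrow>
          excision_eps \<phi> \<le> hf_elem n a b"
proof -
  define F where "F a = eval_formula (hf_carrier n) (hf_elem n) (s(x := a)) \<phi>" for a
  obtain t where t: "\<And>a. t a \<in> hf_level (Suc n)" "\<And>a. bisim n a (t a)"
    using bisim_representative by metis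
  define b where "b = set_encode (t ` {a \<in> hf_carrier n. F a < 0})"
  have b: "set_decode b = t ` {a \<in> hf_carrier n. F a < 0}"
    unfolding b_def by (rule set_encode_inverse) (simp add: finite_hf_level)
  have "b \<in> hf_carrier n" using t(1) by (auto simp: b hf_level.simps(2)[of "Suc n"])
  moreover have "hf_elem n a b = 0" if "a \<in> hf_carrier n" "F a < 0" for a
    unfolding hf_elem_def
  proof (rule freq_eq_0)
    fix j assume "j \<le> n"
    moreover have "near n a b" unfolding near_def b using t(2) that by blast
    ultimately show "\<not> \<not> near j a b" using near_antimono by blast
  qed
  moreover have "excision_eps \<phi> \<le> hf_elem n a b" if a: "a \<in> hf_carrier n" "1 < F a" for a
  proof (cases "set_decode b = {}")
    case True
    then show ?thesis by (simp add: hf_elem_empty excision_eps_def)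
  next
    case False
    then obtain c where c: "c \<in> set_decode b" "hf_dist n a c \<le> hf_elem n a b + 1 / real (Suc n)"
      by (rule hf_elem_attained)
    then obtain a' where a': "a' \<in> hf_carrier n" "F a' < 0" "c = t a'" unfolding b by blast
    have "hf_dist n c a' \<le> freq n (\<lambda>j. j = n)"
      unfolding hf_dist_def
    proof (rule freq_mono)
      fix j assume "j \<le> n" "\<not> bisim (Suc j) c a'"
      then show "j = n"
        using bisim_antimono[of "Suc j" n c a'] bisim_sym[OF t(2)[of a']] a'(3) by fastforce
    qed
    then have dist: "hf_dist n a a' \<le> hf_elem n a b + 2 / real (Suc n)"
      using hf_dist_triangle[of n a a' c] c(2) freq_eq_index_le[of n n] by simp
    have "\<bar>F a - F a'\<bar> \<le> 2 * v \<phi> * hf_dist n a a'"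
      unfolding F_def
    proof (rule eval_formula_lipschitz[OF Le_structure_hf, where \<delta>="hf_dist n"])
      show "hf_dist n a a = 0" for a unfolding hf_dist_def by (rule freq_eq_0) simp
      then show "hf_dist n ((s(x := a)) k) ((s(x := a')) k) \<le> hf_dist n a a'" for k
        by (auto simp: hf_dist_nonneg)
      show "\<bar>hf_elem n c d - hf_elem n c' d'\<bar> \<le> hf_dist n c c' + hf_dist n d d'" for c d c' d'
        by (rule hf_elem_lipschitz)
      show "(s(x := a)) k \<in> hf_carrier n" "(s(x := a')) k \<in> hf_carrier n" for k
        using s a a' by auto
    qed (rule hf_dist_nonneg)
    also have "\<dots> \<le> 2 * v \<phi> * (hf_elem n a b + 2 / real (Suc n))"
      using dist v_nonneg by (intro mult_left_mono) auto
    finally have *: "1 < 2 * v \<phi> * (hf_elem n a b + 2 / real (Suc n))"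
      using a(2) a'(2) by linarith
    then have pos: "0 < v \<phi>" using v_nonneg[of \<phi>] by (cases "v \<phi> = 0") auto
    have "2 * v \<phi> * (2 / real (Suc n)) \<le> 2 / 3"
      using n by (simp add: field_simps)
    then have "1 \<le> 6 * v \<phi> * hf_elem n a b"
      using * by (simp add: distrib_left)
    then have "1 / (6 * v \<phi>) \<le> hf_elem n a b" using pos by (simp add: field_simps)
    moreover have "excision_eps \<phi> \<le> 1 / (6 * v \<phi>)"
      unfolding excision_eps_def using pos by (intro divide_left_mono) auto
    ultimately show ?thesis by linarith
  qed
  ultimately show ?thesis using that unfolding F_def by blast
qed

section \<open>The ultraproduct\<close>

lemma H_extensionality_uprod_hf:
  assumes U: "ultrafilter U" and le: "U \<le> sequentially"
  shows "H_extensionality (uprod_carrier hf_carrier) (uprod_elem U hf_elem)"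
proof -
  let ?M = "uprod_carrier hf_carrier" and ?e = "uprod_elem U hf_elem"
  have nb: "U \<noteq> bot" using U by (simp add: ultrafilter_def)
  \<comment> \<open>The right-hand side of the axiom is the value of a formula, so that its error passes to the limit.\<close>
  define \<chi> where "\<chi> = InfF 2 (MinF (Plus
      (SupF 3 (MaxF (Plus (Elem 3 0) (Scale (-1) (Elem 3 2))) (Plus (Elem 3 2) (Scale (-1) (Elem 3 0)))))
      (Scale 2 (Elem 2 1))) One)"
  have abs: "max (p - q) (q - p) = \<bar>p - q\<bar>" for p q :: real by auto
  have \<chi>: "eval_formula N f s \<chi> = (INF z\<in>N. min (d_e N f (s 0) z + 2 * f z (s 1)) 1)"
    for s and N :: "'z set" and f
    by (simp add: \<chi>_def d_e_def abs)
  define R where "R x y = (INF z\<in>?M. min (d_e ?M ?e x z + 2 * ?e z y) 1)" for x y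
  have "?e x y = R x y" if x: "x \<in> ?M" and y: "y \<in> ?M" for x y
  proof -
    define s where "s k = (if k = 0 then x else y)" for k :: nat
    let ?\<psi> = "Plus (Elem 0 1) (Scale (-1) \<chi>)"
    define g where "g i = eval_formula (hf_carrier i) (hf_elem i) (\<lambda>k. s k i) ?\<psi>" for i
    have "(g \<longlongrightarrow> eval_formula ?M ?e s ?\<psi>) U"
      unfolding g_def by (rule los[OF U Le_structure_hf finite_hf_level]) (simp add: s_def x y)
    moreover have "(g \<longlongrightarrow> 0) sequentially"
    proof (rule tendsto_0_le[where K=1])
      have "\<bar>g i\<bar> \<le> 1 / real (Suc i)" for i
        using hf_H_extensionality[of "x i" i "y i"] x y
        by (simp add: g_def \<chi> s_def uprod_carrier_def)
      then show "eventually (\<lambda>i. norm (g i) \<le> norm (1 / real (Suc i)) * 1) sequentially"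
        by (intro always_eventually) simp
      show "(\<lambda>i. 1 / real (Suc i)) \<longlonglongrightarrow> 0"
        using LIMSEQ_inverse_real_of_nat by (simp add: inverse_eq_divide)
    qed
    ultimately have "eval_formula ?M ?e s ?\<psi> = 0"
      by (rule tendsto_unique[OF nb _ tendsto_mono[OF le]])
    then show ?thesis by (simp add: \<chi> s_def R_def)
  qed
  then have "(\<lambda>(x, y). \<bar>?e x y - R x y\<bar>) ` (?M \<times> ?M) = (\<lambda>_. 0) ` (?M \<times> ?M)"
    by (intro image_cong) auto
  moreover have "?M \<noteq> {}"
    using Le_structure_uprod[OF U Le_structure_hf] by (simp add: Le_structure_def)
  ultimately show ?thesis by (simp add: H_extensionality_def flip: R_def)
qed

text \<open>
  A witness in the ultraproduct is a sequence of witnesses in the factors.  The factors with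
  \<open>n + 1 < 6 v(\<phi>)\<close> need not have one, but they are finite in number, and \<open>U\<close> ignores them.
\<close>

lemma excision_uprod_hf:
  assumes U: "ultrafilter U" and le: "U \<le> sequentially"
  shows "excision (uprod_carrier hf_carrier) (uprod_elem U hf_elem)"
  unfolding excision_def
proof (intro allI impI)
  let ?M = "uprod_carrier hf_carrier" and ?e = "uprod_elem U hf_elem"
  fix \<phi> and x z :: nat
  assume xz: "x \<noteq> z" and z: "z \<notin> free_vars \<phi>"
  have nb: "U \<noteq> bot" using U by (simp add: ultrafilter_def)
  have M: "Le_structure ?M ?e" by (rule Le_structure_uprod[OF U Le_structure_hf])
  then have ne: "?M \<noteq> {}" by (simp add: Le_structure_def)
  define F where "F s a b = eval_formula ?M ?e (s(x := a, z := b)) \<phi>" for s a b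
  define H where "H s a b = max (min (?e a b) (- F s a b)) (min (excision_eps \<phi> - ?e a b) (F s a b - 1))"
    for s a b
  have F: "F s a b = eval_formula ?M ?e (s(x := a)) \<phi>" for s a b
    unfolding F_def using z by (intro eval_formula_cong) auto
  have H_bound: "\<bar>H s a b\<bar> \<le> 2 + v \<phi>" if "range s \<subseteq> ?M" "a \<in> ?M" "b \<in> ?M" for s a b
  proof -
    have "\<bar>F s a b\<bar> \<le> v \<phi>"
      unfolding F_def by (rule abs_eval_formula_le_v[OF M]) (use that in auto)
    moreover have "0 \<le> ?e a b" "?e a b \<le> 1" using M that by (auto simp: Le_structure_def)
    moreover have "0 \<le> excision_eps \<phi>" "excision_eps \<phi> \<le> 1"
      by (auto simp: excision_eps_def)
    ultimately show ?thesis unfolding H_def by (auto simp: abs_le_iff max_def min_def)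
  qed
  have "\<exists>b\<in>?M. \<forall>a\<in>?M. H s a b \<le> 0" if s: "range s \<subseteq> ?M" for s
  proof -
    define Fi where "Fi i a = eval_formula (hf_carrier i) (hf_elem i) ((\<lambda>k. s k i)(x := a)) \<phi>" for i a
    have si: "s k i \<in> hf_carrier i" for k i using s by (auto simp: uprod_carrier_def)
    have "\<exists>b. b \<in> hf_carrier i \<and> (6 * v \<phi> \<le> real (Suc i) \<longrightarrow> (\<forall>a\<in>hf_carrier i.
        (Fi i a < 0 \<longrightarrow> hf_elem i a b = 0) \<and> (1 < Fi i a \<longrightarrow> excision_eps \<phi> \<le> hf_elem i a b)))" for i
    proof (cases "6 * v \<phi> \<le> real (Suc i)")
      case True
      then show ?thesis
        using hf_excision[where s="\<lambda>k. s k i" and n=i and \<phi>=\<phi> and x=x, OF si True] unfolding Fi_def by metis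
    next
      case False
      then show ?thesis using si by blast
    qed
    then obtain b where b: "\<And>i. b i \<in> hf_carrier i"
      and b': "\<And>i a. \<lbrakk>6 * v \<phi> \<le> real (Suc i); a \<in> hf_carrier i; Fi i a < 0\<rbrakk> \<Longrightarrow> hf_elem i a (b i) = 0"
        "\<And>i a. \<lbrakk>6 * v \<phi> \<le> real (Suc i); a \<in> hf_carrier i; 1 < Fi i a\<rbrakk> \<Longrightarrow> excision_eps \<phi> \<le> hf_elem i a (b i)"
      by metis
    have bM: "b \<in> ?M" using b by (simp add: uprod_carrier_def)
    have "H s a b \<le> 0" if a: "a \<in> ?M" for a
    proof -
      have ai: "a i \<in> hf_carrier i" for i using a by (simp add: uprod_carrier_def)
      have "(\<lambda>k. (s(x := a)) k i) = (\<lambda>k. s k i)(x := a i)" for i by auto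
      moreover have "(s(x := a)) k \<in> ?M" for k using a s by auto
      ultimately have "((\<lambda>i. Fi i (a i)) \<longlongrightarrow> F s a b) U"
        using los[OF U Le_structure_hf finite_hf_level, where s="s(x := a)" and \<phi>=\<phi>]
        by (simp add: Fi_def F del: fun_upd_apply)
      moreover have "((\<lambda>i. hf_elem i (a i) (b i)) \<longlongrightarrow> ?e a b) U"
        by (rule uprod_elem_tendsto[OF U Le_structure_hf a bM])
      ultimately have "((\<lambda>i. max (min (hf_elem i (a i) (b i)) (- Fi i (a i)))
           (min (excision_eps \<phi> - hf_elem i (a i) (b i)) (Fi i (a i) - 1))) \<longlongrightarrow> H s a b) U"
        unfolding H_def by (intro tendsto_intros)
      moreover have "eventually (\<lambda>i. max (min (hf_elem i (a i) (b i)) (- Fi i (a i)))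
           (min (excision_eps \<phi> - hf_elem i (a i) (b i)) (Fi i (a i) - 1)) \<le> 0) U"
      proof (rule filter_leD[OF le], rule eventually_mono)
        show "eventually (\<lambda>i. i \<ge> nat \<lceil>6 * v \<phi>\<rceil>) sequentially" by (rule eventually_ge_at_top)
        fix i assume "i \<ge> nat \<lceil>6 * v \<phi>\<rceil>"
        then have i: "6 * v \<phi> \<le> real (Suc i)" by linarith
        show "max (min (hf_elem i (a i) (b i)) (- Fi i (a i)))
           (min (excision_eps \<phi> - hf_elem i (a i) (b i)) (Fi i (a i) - 1)) \<le> 0"
          using b'(1)[OF i ai] b'(2)[OF i ai] by (simp add: min_le_iff_disj) linarith
      qed
      ultimately show ?thesis using nb by (rule tendsto_upperbound)
    qed
    then show ?thesis using bM by blast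
  qed
  note witness = this
  have "(INF b\<in>?M. SUP a\<in>?M. H s a b) \<le> 0" if s: "range s \<subseteq> ?M" for s
  proof -
    obtain b where b: "b \<in> ?M" "\<And>a. a \<in> ?M \<Longrightarrow> H s a b \<le> 0" using witness[OF s] by blast
    show ?thesis
    proof (rule cINF_lower2[OF _ b(1)])
      have "\<bar>SUP a\<in>?M. H s a c\<bar> \<le> 2 + v \<phi>" if "c \<in> ?M" for c
        by (rule cSup_abs_le) (use ne H_bound[OF s _ that] in auto)
      then show "bdd_below ((\<lambda>b. SUP a\<in>?M. H s a b) ` ?M)" by (rule bdd_image_of_abs_le)
      show "(SUP a\<in>?M. H s a b) \<le> 0" using b(2) ne by (intro cSUP_least)
    qed
  qed
  then show "(SUP s\<in>{s. range s \<subseteq> ?M}. INF b\<in>?M. SUP a\<in>?M.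
           max (min (?e a b) (- eval_formula ?M ?e (s(x := a, z := b)) \<phi>))
               (min (excision_eps \<phi> - ?e a b) (eval_formula ?M ?e (s(x := a, z := b)) \<phi> - 1))) \<le> 0"
    using ne unfolding H_def F_def by (intro cSUP_least) auto
qed

theorem theorem6p16:
  "\<exists>(M :: universe set) (e :: universe \<Rightarrow> universe \<Rightarrow> real).
     MSE_model M e \<and> pseudo_finite M e"
proof -
  obtain U :: "nat filter" where U: "U \<le> sequentially" "ultrafilter U"
    using ultrafilter_below_exists[OF sequentially_bot] by blast
  have "MSE_model (uprod_carrier hf_carrier) (uprod_elem U hf_elem)"
    unfolding MSE_model_def
    using Le_structure_uprod[where A=hf_carrier and E=hf_elem, OF U(2) Le_structure_hf] H_extensionality_uprod_hf[OF U(2,1)]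
      excision_uprod_hf[OF U(2,1)] by blast
  moreover have "pseudo_finite (uprod_carrier hf_carrier) (uprod_elem U hf_elem)"
    by (rule pseudo_finite_uprod[OF U(2) Le_structure_hf finite_hf_level])
  ultimately show ?thesis by blast
qed

end
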